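(* Let $a\in\mathbb{C}$ with $\mathrm{Re}(a)=0$ be such that $$\varphi(z)=\frac{(2-a)z+a}{-az+2+a},\qquad z\in\mathbb{D},$$ is a parabolic automorphism of the open unit disk $\mathbb{D}$ (that is, $a\neq 0$). Let $C_\varphi f=f\circ\varphi$ be the composition operator on the Bergman space $L^2_a$. Then the set of extended eigenvalues of $C_\varphi$ is the unit circle: $$\mathrm{Ext}(C_\varphi)=\partial\mathbb{D}=\{\lambda\in\mathbb{C}:|\lambda|=1\}.$$
   Context: The Bergman space $L^2_a$ is the Hilbert space of holomorphic functions $f$ on the open unit disk $\mathbb{D}$ with $\|f\|^2=\frac{1}{\pi}\int_{\mathbb{D}}|f(z)|^2\,dA(z)<\infty$, where $dA$ is Lebesgue area measure. (The subscript $a$ in $L^2_a$ is part of the notation and unrelated to the parameter $a$.) For a bounded linear operator $A$ on a complex Hilbert space $H$, a scalar $\lambda\in\mathbb{C}$ is an extended eigenvalue of $A$ if there is a nonzero bounded linear operator $X$ on $H$ with $AX=\lambda XA$; $\mathrm{Ext}(A)$ denotes the set of all extended eigenvalues of $A$. A parabolic automorphism of $\mathbb{D}$ is a non-identity linear fractional automorphism of $\mathbb{D}$ having exactly one fixed point in the Riemann sphere, which then lies on the unit circle. *)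

theory Defs
  imports "HOL-Complex_Analysis.Complex_Analysis"
begin

subsection \<open>Extended eigenvalues\<close>

text \<open>
  A complex inner product is determined by its real part, so a complex inner product space is a
  real inner product space with a compatible complex scalar multiplication satisfying
  \<open>norm (c x) = |c| norm x\<close>; the sesquilinear form is recovered by polarization.
  Completeness plays no role in the definition of extended eigenvalues and is not required here.
\<close>

class complex_inner_space = real_inner +
  fixes scaleC :: "complex \<Rightarrow> 'a \<Rightarrow> 'a" (infixr "*\<^sub>C" 75)
  assumes scaleC_add_right: "c *\<^sub>C (x + y) = c *\<^sub>C x + c *\<^sub>C y"
    and scaleC_add_left: "(c + d) *\<^sub>C x = c *\<^sub>C x + d *\<^sub>C x"
    and scaleC_scaleC: "c *\<^sub>C d *\<^sub>C x = (c * d) *\<^sub>C x"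
    and scaleC_of_real: "complex_of_real r *\<^sub>C x = r *\<^sub>R x"
    and norm_scaleC: "norm (c *\<^sub>C x) = cmod c * norm x"

definition bounded_clinear :: "('a::complex_inner_space \<Rightarrow> 'b::complex_inner_space) \<Rightarrow> bool" where
  "bounded_clinear T \<longleftrightarrow> bounded_linear T \<and> (\<forall>c x. T (c *\<^sub>C x) = c *\<^sub>C T x)"

text \<open>Meant for bounded linear \<open>A\<close>.\<close>

definition extended_eigenvalues :: "('a::complex_inner_space \<Rightarrow> 'a) \<Rightarrow> complex set" where
  "extended_eigenvalues A =
     {\<mu>. \<exists>X. bounded_clinear X \<and> X \<noteq> (\<lambda>f. 0) \<and> (\<forall>f. A (X f) = \<mu> *\<^sub>C X (A f))}"


subsection \<open>The Bergman space\<close>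

abbreviation unit_disk :: "complex set" ("\<D>") where
  "\<D> \<equiv> ball 0 1"

text \<open>
  Functions on the disk are represented by total functions that vanish off the disk, so that
  equality of elements is equality of functions on the disk.
\<close>

typedef bergman = "{f :: complex \<Rightarrow> complex.
    f holomorphic_on \<D> \<and> (\<forall>z. z \<notin> \<D> \<longrightarrow> f z = 0) \<and>
    set_integrable lborel \<D> (\<lambda>z. (cmod (f z))\<^sup>2)}"
  morphisms bergman_fun Abs_bergman
  by (rule exI[of _ "\<lambda>_. 0"]) (simp add: set_integrable_def)

setup_lifting type_definition_bergman

lemma bergman_holomorphic: "bergman_fun f holomorphic_on \<D>"
  using bergman_fun[of f] by auto

lemma bergman_fun_outside: "z \<notin> \<D> \<Longrightarrow> bergman_fun f z = 0"
  using bergman_fun[of f] by auto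

lemma bergman_eqI:
  assumes "\<And>z. z \<in> \<D> \<Longrightarrow> bergman_fun f z = bergman_fun g z"
  shows "f = g"
  using assms bergman_fun_outside by (metis bergman_fun_inject ext)

lemma holomorphic_set_borel_measurable:
  assumes "f holomorphic_on \<D>"
  shows "set_borel_measurable lborel \<D> f"
  using borel_measurable_continuous_on_indicator[OF _ holomorphic_on_imp_continuous_on[OF assms]]
  by (simp add: set_borel_measurable_def)

lemma set_integrable_sq_add:
  assumes "f holomorphic_on \<D>" "g holomorphic_on \<D>"
    and "set_integrable lborel \<D> (\<lambda>z. (cmod (f z))\<^sup>2)"
    and "set_integrable lborel \<D> (\<lambda>z. (cmod (g z))\<^sup>2)"
  shows "set_integrable lborel \<D> (\<lambda>z. (cmod (f z + g z))\<^sup>2)"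
proof -
  have bound: "(cmod (x + y))\<^sup>2 \<le> 2 * (cmod x)\<^sup>2 + 2 * (cmod y)\<^sup>2" for x y
  proof -
    have "(cmod (x + y))\<^sup>2 \<le> (cmod x + cmod y)\<^sup>2"
      by (simp add: norm_triangle_ineq power_mono)
    also have "\<dots> \<le> 2 * (cmod x)\<^sup>2 + 2 * (cmod y)\<^sup>2"
      using sum_squares_bound[of "cmod x" "cmod y"] by (simp add: power2_sum)
    finally show ?thesis .
  qed
  have "set_integrable lborel \<D> (\<lambda>z. 2 * (cmod (f z))\<^sup>2 + 2 * (cmod (g z))\<^sup>2)"
    by (intro set_integral_add set_integrable_mult_right assms)
  then show ?thesis
  proof (rule set_integrable_bound)
    have "continuous_on \<D> (\<lambda>z. (cmod (f z + g z))\<^sup>2)"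
      by (intro continuous_intros holomorphic_on_imp_continuous_on assms)
    from borel_measurable_continuous_on_indicator[OF _ this]
    show "set_borel_measurable lborel \<D> (\<lambda>z. (cmod (f z + g z))\<^sup>2)"
      by (simp add: set_borel_measurable_def)
  qed (use bound in auto)
qed

instantiation bergman :: real_vector
begin

lift_definition zero_bergman :: bergman is "\<lambda>z. 0"
  by (simp add: set_integrable_def)

lift_definition plus_bergman :: "bergman \<Rightarrow> bergman \<Rightarrow> bergman" is "\<lambda>f g z. f z + g z"
  by (auto intro!: holomorphic_intros set_integrable_sq_add)

lift_definition uminus_bergman :: "bergman \<Rightarrow> bergman" is "\<lambda>f z. - f z"
  by (auto intro!: holomorphic_intros)

lift_definition minus_bergman :: "bergman \<Rightarrow> bergman \<Rightarrow> bergman" is "\<lambda>f g z. f z - g z"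
proof -
  fix f g :: "complex \<Rightarrow> complex"
  assume *: "f holomorphic_on \<D> \<and> (\<forall>z. z \<notin> \<D> \<longrightarrow> f z = 0) \<and>
      set_integrable lborel \<D> (\<lambda>z. (cmod (f z))\<^sup>2)"
    "g holomorphic_on \<D> \<and> (\<forall>z. z \<notin> \<D> \<longrightarrow> g z = 0) \<and>
      set_integrable lborel \<D> (\<lambda>z. (cmod (g z))\<^sup>2)"
  then have "set_integrable lborel \<D> (\<lambda>z. (cmod (f z + - g z))\<^sup>2)"
    by (intro set_integrable_sq_add) (auto intro!: holomorphic_intros)
  with * show "(\<lambda>z. f z - g z) holomorphic_on \<D> \<and> (\<forall>z. z \<notin> \<D> \<longrightarrow> f z - g z = 0) \<and>
      set_integrable lborel \<D> (\<lambda>z. (cmod (f z - g z))\<^sup>2)"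
    by (auto intro!: holomorphic_intros)
qed

lift_definition scaleR_bergman :: "real \<Rightarrow> bergman \<Rightarrow> bergman" is
  "\<lambda>r f z. complex_of_real r * f z"
  by (auto intro!: holomorphic_intros simp: norm_mult power_mult_distrib)

instance
  by standard (transfer; simp add: algebra_simps fun_eq_iff)+

end

lemma set_integrable_inner:
  assumes "f holomorphic_on \<D>" "g holomorphic_on \<D>"
    and "set_integrable lborel \<D> (\<lambda>z. (cmod (f z))\<^sup>2)"
    and "set_integrable lborel \<D> (\<lambda>z. (cmod (g z))\<^sup>2)"
  shows "set_integrable lborel \<D> (\<lambda>z. f z \<bullet> g z)"
proof -
  have "set_integrable lborel \<D> (\<lambda>z. (cmod (f z))\<^sup>2 + (cmod (g z))\<^sup>2)"
    by (intro set_integral_add assms)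
  then show ?thesis
  proof (rule set_integrable_bound)
    have "continuous_on \<D> (\<lambda>z. f z \<bullet> g z)"
      by (intro continuous_intros holomorphic_on_imp_continuous_on assms)
    from borel_measurable_continuous_on_indicator[OF _ this]
    show "set_borel_measurable lborel \<D> (\<lambda>z. f z \<bullet> g z)"
      by (simp add: set_borel_measurable_def)
    have "\<bar>x \<bullet> y\<bar> \<le> (cmod x)\<^sup>2 + (cmod y)\<^sup>2" for x y
    proof -
      have "\<bar>x \<bullet> y\<bar> \<le> cmod x * cmod y"
        by (rule Cauchy_Schwarz_ineq2)
      also have "\<dots> \<le> (cmod x)\<^sup>2 + (cmod y)\<^sup>2"
        using sum_squares_bound[of "cmod x" "cmod y"]
          mult_nonneg_nonneg[OF norm_ge_zero norm_ge_zero, of x y] by linarith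
      finally show ?thesis .
    qed
    then show "AE z in lborel. z \<in> \<D> \<longrightarrow>
        norm (f z \<bullet> g z) \<le> norm ((cmod (f z))\<^sup>2 + (cmod (g z))\<^sup>2)"
      by auto
  qed
qed

lemma holomorphic_sq_integral_0:
  assumes f: "f holomorphic_on \<D>"
    and int: "set_integrable lborel \<D> (\<lambda>z. (cmod (f z))\<^sup>2)"
    and zero: "(LINT z:\<D>|lborel. (cmod (f z))\<^sup>2) = 0" and "z \<in> \<D>"
  shows "f z = 0"
proof (rule ccontr)
  assume "f z \<noteq> 0"
  define S where "S = {z \<in> \<D>. f z \<noteq> 0}"
  have "S = \<D> \<inter> f -` (- {0})" by (auto simp: S_def)
  then have S: "open S"
    using continuous_open_preimage[OF holomorphic_on_imp_continuous_on[OF f], of "- {0}"]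
    by (simp add: open_Compl)
  have "AE z in lborel. indicat_real \<D> z *\<^sub>R (cmod (f z))\<^sup>2 = 0"
    using int zero integral_nonneg_eq_0_iff_AE[of lborel "\<lambda>z. indicat_real \<D> z *\<^sub>R (cmod (f z))\<^sup>2"]
    by (simp add: set_integrable_def set_lebesgue_integral_def)
  then have "AE z in lborel. z \<notin> S"
    by eventually_elim (auto simp: S_def indicator_def split: if_splits)
  then have "S \<in> null_sets lborel"
    using S by (subst AE_iff_null_sets) auto
  then have "negligible S"
    using negligible_iff_null_sets null_sets_completionI by blast
  then show False
    using open_not_negligible[OF S] \<open>f z \<noteq> 0\<close> \<open>z \<in> \<D>\<close> by (auto simp: S_def)
qed

text \<open>
  The real inner product of two complex numbers \<open>u\<close> and \<open>v\<close> is the real part of \<open>u * cnj v\<close>, so this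
  is the real part of the usual inner product of the Bergman space.
\<close>

instantiation bergman :: complex_inner_space
begin

definition inner_bergman :: "bergman \<Rightarrow> bergman \<Rightarrow> real" where
  "inner_bergman f g = 1 / pi * (LINT z:\<D>|lborel. bergman_fun f z \<bullet> bergman_fun g z)"

definition norm_bergman :: "bergman \<Rightarrow> real" where
  "norm_bergman f = sqrt (1 / pi * (LINT z:\<D>|lborel. (cmod (bergman_fun f z))\<^sup>2))"

definition dist_bergman :: "bergman \<Rightarrow> bergman \<Rightarrow> real" where
  "dist_bergman f g = norm (f - g)"

definition sgn_bergman :: "bergman \<Rightarrow> bergman" where
  "sgn_bergman f = inverse (norm f) *\<^sub>R f"

definition uniformity_bergman :: "(bergman \<times> bergman) filter" where
  "uniformity_bergman = (INF e\<in>{0<..}. principal {(f, g). dist f g < e})"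

definition open_bergman :: "bergman set \<Rightarrow> bool" where
  "open_bergman U \<longleftrightarrow> (\<forall>f\<in>U. \<forall>\<^sub>F (f', g) in uniformity. f' = f \<longrightarrow> g \<in> U)"

lift_definition scaleC_bergman :: "complex \<Rightarrow> bergman \<Rightarrow> bergman" is "\<lambda>c f z. c * f z"
  by (auto intro!: holomorphic_intros simp: norm_mult power_mult_distrib)

instance
proof
  fix f g h :: bergman and r :: real and c d :: complex and U :: "bergman set"
  have integrable: "set_integrable lborel \<D> (\<lambda>z. bergman_fun f z \<bullet> bergman_fun g z)" for f g
    using bergman_fun[of f] bergman_fun[of g] by (intro set_integrable_inner) auto
  show "dist f g = norm (f - g)" "sgn f = f /\<^sub>R norm f"
    by (simp_all add: dist_bergman_def sgn_bergman_def)
  show "uniformity = (INF e\<in>{0<..}. principal {(f :: bergman, g). dist f g < e})"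
    by (rule uniformity_bergman_def)
  show "open U \<longleftrightarrow> (\<forall>f\<in>U. \<forall>\<^sub>F (f', g) in uniformity. f' = f \<longrightarrow> g \<in> U)"
    by (rule open_bergman_def)
  show "f \<bullet> g = g \<bullet> f"
    by (simp add: inner_bergman_def inner_commute)
  show "(f + g) \<bullet> h = f \<bullet> h + g \<bullet> h"
    by (simp add: inner_bergman_def plus_bergman.rep_eq inner_add_left
        set_integral_add(2)[OF integrable integrable] algebra_simps add_divide_distrib)
  show "(r *\<^sub>R f) \<bullet> g = r * (f \<bullet> g)"
    by (simp add: inner_bergman_def scaleR_bergman.rep_eq scaleR_conv_of_real[symmetric])
  show nonneg: "0 \<le> f \<bullet> f"
    by (auto simp: inner_bergman_def set_lebesgue_integral_def intro!: integral_nonneg)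
  show "f \<bullet> f = 0 \<longleftrightarrow> f = 0"
  proof
    assume "f \<bullet> f = 0"
    then have "(LINT z:\<D>|lborel. (cmod (bergman_fun f z))\<^sup>2) = 0"
      by (simp add: inner_bergman_def dot_square_norm)
    then show "f = 0"
      using bergman_fun[of f]
      by (intro bergman_eqI) (auto simp: zero_bergman.rep_eq intro: holomorphic_sq_integral_0)
  qed (simp add: inner_bergman_def zero_bergman.rep_eq)
  show "norm f = sqrt (f \<bullet> f)"
    by (simp add: norm_bergman_def inner_bergman_def dot_square_norm)
  show "c *\<^sub>C (f + g) = c *\<^sub>C f + c *\<^sub>C g" "(c + d) *\<^sub>C f = c *\<^sub>C f + d *\<^sub>C f"
    "c *\<^sub>C d *\<^sub>C f = (c * d) *\<^sub>C f" "complex_of_real r *\<^sub>C f = r *\<^sub>R f"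
    by (transfer; simp add: algebra_simps fun_eq_iff)+
  show "norm (c *\<^sub>C f) = cmod c * norm f"
    by (simp add: norm_bergman_def scaleC_bergman.rep_eq norm_mult power_mult_distrib
        real_sqrt_mult real_sqrt_divide)
qed

end

text \<open>
  Meant for self-maps \<open>\<phi>\<close> of the disk that map the Bergman space into itself under composition, such
  as automorphisms of the disk; then the argument of \<^const>\<open>Abs_bergman\<close> lies in the carrier.
\<close>

definition composition_operator :: "(complex \<Rightarrow> complex) \<Rightarrow> bergman \<Rightarrow> bergman" where
  "composition_operator \<phi> f = Abs_bergman (\<lambda>z. if z \<in> \<D> then bergman_fun f (\<phi> z) else 0)"


subsection \<open>Parabolic automorphisms of the disk\<close>

text \<open>
  The linear fractional map with coefficients \<open>p, q, r, s\<close> on the Riemann sphere, where \<open>None\<close>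
  is the point at infinity.
\<close>

definition linear_fractional ::
    "complex \<Rightarrow> complex \<Rightarrow> complex \<Rightarrow> complex \<Rightarrow> complex option \<Rightarrow> complex option" where
  "linear_fractional p q r s w =
     (case w of
        None \<Rightarrow> if r = 0 then None else Some (p / r)
      | Some z \<Rightarrow> if r * z + s = 0 then None else Some ((p * z + q) / (r * z + s)))"

definition parabolic_automorphism :: "(complex \<Rightarrow> complex) \<Rightarrow> bool" where
  "parabolic_automorphism \<phi> \<longleftrightarrow>
     bij_betw \<phi> \<D> \<D> \<and> (\<exists>z\<in>\<D>. \<phi> z \<noteq> z) \<and>
     (\<exists>p q r s. p * s - q * r \<noteq> 0 \<and>
        (\<forall>z\<in>\<D>. linear_fractional p q r s (Some z) = Some (\<phi> z)) \<and>
        (\<exists>!w. linear_fractional p q r s w = w))"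


lemma parabolic_automorphism_iff:
  assumes a: "Re a = 0"
    and \<phi>: "\<And>z. z \<in> \<D> \<Longrightarrow> \<phi> z = ((2 - a) * z + a) / (- a * z + 2 + a)"
  shows "parabolic_automorphism \<phi> \<longleftrightarrow> a \<noteq> 0"
proof
  assume "parabolic_automorphism \<phi>"
  then obtain z where "z \<in> \<D>" "\<phi> z \<noteq> z"
    unfolding parabolic_automorphism_def by blast
  with \<phi>[of z] show "a \<noteq> 0" by auto
next
  assume "a \<noteq> 0"
  define \<psi> where "\<psi> b z = ((2 - b) * z + b) / (- b * z + 2 + b)" for b z :: complex
  have key: "cmod ((2 - b) * z + b) < cmod (- b * z + 2 + b)"
    if "Re b = 0" "z \<in> \<D>" for b z
  proof -
    have "(cmod (- b * z + 2 + b))\<^sup>2 - (cmod ((2 - b) * z + b))\<^sup>2 = 4 * (1 - (cmod z)\<^sup>2)"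
      using that(1) unfolding cmod_power2 by (simp add: power2_eq_square algebra_simps)
    moreover have "(cmod z)\<^sup>2 < 1"
      using that(2) by (simp add: power_less_one_iff)
    ultimately have "(cmod ((2 - b) * z + b))\<^sup>2 < (cmod (- b * z + 2 + b))\<^sup>2"
      by simp
    then show ?thesis
      by (rule power_less_imp_less_base) simp
  qed
  have nz: "- b * z + 2 + b \<noteq> 0" if "Re b = 0" "z \<in> \<D>" for b z
    using key[OF that] by (metis norm_ge_zero norm_zero not_less)
  have maps: "\<psi> b z \<in> \<D>" if "Re b = 0" "z \<in> \<D>" for b z
    using key[OF that] nz[OF that] by (simp add: \<psi>_def norm_divide divide_less_eq)
  have inv: "\<psi> (- b) (\<psi> b z) = z" if "Re b = 0" "z \<in> \<D>" for b z
  proof -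
    define d where "d = - b * z + 2 + b"
    have d: "d \<noteq> 0" using nz[OF that] by (simp add: d_def)
    have "(2 + b) * ((2 - b) * z + b) - b * d = 4 * z"
      "b * ((2 - b) * z + b) + (2 - b) * d = 4"
      by (simp_all add: d_def algebra_simps)
    moreover define n where "n = (2 - b) * z + b"
    ultimately have n: "(2 + b) * n - b * d = 4 * z" "b * n + (2 - b) * d = 4"
      by simp_all
    have "\<psi> b z = n / d" by (simp add: \<psi>_def d_def n_def)
    moreover have "(2 + b) * (n / d) - b = 4 * z / d"
      using d n(1) by (simp add: field_simps)
    moreover have "b * (n / d) + 2 - b = 4 / d"
      using d n(2) by (simp add: field_simps)
    ultimately show ?thesis
      using d by (simp add: \<psi>_def[of "- b"])
  qed
  have "bij_betw (\<psi> a) \<D> \<D>"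
    by (rule bij_betw_byWitness[where f' = "\<psi> (- a)"])
      (use a inv[of a] inv[of "- a"] maps[of a] maps[of "- a"] in auto)
  then have bij: "bij_betw \<phi> \<D> \<D>"
    by (subst bij_betw_cong[of _ _ "\<psi> a"]) (simp_all add: \<phi> \<psi>_def)
  have "2 + a \<noteq> 0" using nz[of a 0] a by simp
  then have move: "\<phi> 0 \<noteq> 0" using \<phi>[of 0] \<open>a \<noteq> 0\<close> by simp
  have fixed: "linear_fractional (2 - a) a (- a) (2 + a) w = w \<longleftrightarrow> w = Some 1" for w
  proof (cases w)
    case None
    then show ?thesis using \<open>a \<noteq> 0\<close> by (simp add: linear_fractional_def)
  next
    case (Some z)
    have "(2 - a) * z + a - z * (- a * z + (2 + a)) = a * (z - 1)\<^sup>2"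
      by (simp add: power2_eq_square algebra_simps)
    then have eq: "(2 - a) * z + a = z * (- a * z + (2 + a)) \<longleftrightarrow> z = 1"
      using \<open>a \<noteq> 0\<close> by (subst eq_iff_diff_eq_0) simp
    show ?thesis
    proof (cases "- a * z + (2 + a) = 0")
      case True
      then have "z \<noteq> 1" by auto
      with True Some show ?thesis by (simp add: linear_fractional_def)
    next
      case False
      then have "((2 - a) * z + a) / (- a * z + (2 + a)) = z \<longleftrightarrow> z = 1"
        using eq by (simp add: divide_eq_eq)
      with False Some show ?thesis by (simp add: linear_fractional_def)
    qed
  qed
  have "(2 - a) * (2 + a) - a * (- a) \<noteq> 0"
    by (simp add: algebra_simps)
  moreover have "\<forall>z\<in>\<D>. linear_fractional (2 - a) a (- a) (2 + a) (Some z) = Some (\<phi> z)"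
    using nz[OF a] by (simp add: linear_fractional_def \<phi> flip: add.assoc)
  moreover have "\<exists>!w. linear_fractional (2 - a) a (- a) (2 + a) w = w"
    unfolding fixed by (rule ex1I[of _ "Some 1"]) (rule refl)
  ultimately have "\<exists>p q r s. p * s - q * r \<noteq> 0 \<and>
      (\<forall>z\<in>\<D>. linear_fractional p q r s (Some z) = Some (\<phi> z)) \<and>
      (\<exists>!w. linear_fractional p q r s w = w)"
    by (intro exI[of _ "2 - a"] exI[of _ a] exI[of _ "- a"] exI[of _ "2 + a"] conjI)
  moreover have "\<exists>z\<in>\<D>. \<phi> z \<noteq> z"
    using move by (intro bexI[of _ 0]) simp_all
  ultimately show "parabolic_automorphism \<phi>"
    unfolding parabolic_automorphism_def using bij by (intro conjI)
qed

end

theory Submission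
  imports Defs "HOL-Real_Asymp.Real_Asymp"
begin

text \<open>
  The coordinate \<open>w = (z + 1) / (z - 1)\<close> maps the disk onto the left half-plane and turns \<open>\<phi>\<close>
  into the translation by \<open>- a\<close>, which is parallel to the boundary because \<open>a\<close> is imaginary.
  So \<open>\<phi>\<close> is the time-one map of a group of automorphisms: its iterates, forward and backward, are
  again maps of the same form with \<open>a\<close> replaced by \<open>n a\<close>. Both inclusions come from this picture.

  \<^emph>\<open>Every extended eigenvalue is unimodular.\<close> Write \<open>A\<close> for the composition operator. It is
  invertible, and \<open>A X = \<mu> X A\<close> iterates to \<open>\<mu>\<^sup>n X = A\<^sup>n X A\<^sup>-\<^sup>n\<close>. A change of variables bounds the
  norm of composition with an automorphism by the largest modulus of the derivative of its inverse,
  and for the \<open>n\<close>-th iterate this is at most \<open>(1 + n |a|)\<^sup>2\<close> (\<^emph>\<open>cmod_deriv_parabolic_flow_le\<close>,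
  \<^emph>\<open>norm_composition_parabolic_le\<close>). The right-hand side thus grows polynomially in \<open>n\<close>, while the
  left-hand side grows exponentially if \<open>|\<mu>| > 1\<close> and \<open>X \<noteq> 0\<close>; the case \<open>|\<mu>| < 1\<close> is the same
  statement about the inverse of \<open>A\<close> (\<^emph>\<open>extended_eigenvalue_polynomial_growth\<close>).

  \<^emph>\<open>Every unimodular number occurs.\<close> For real \<open>t \<ge> 0\<close> the function \<open>e = exp (t w)\<close> is bounded on the
  disk, and translating \<open>w\<close> by \<open>- a\<close> multiplies it by \<open>\<mu> = exp (- t a)\<close>. Since \<open>A (e f) = (e \<circ> \<phi>) (A f)\<close>,
  multiplication by \<open>e\<close> is an intertwiner for this \<open>\<mu>\<close>. As \<open>t\<close> runs through the half-line, \<open>\<mu>\<close> runs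
  through the whole circle.
\<close>

section \<open>Holomorphic change of variables\<close>

text \<open>
  Jacobian determinants belong to matrices, so integrals over the complex plane are moved to
  \<open>real^2\<close>, transformed there, and moved back.
\<close>

definition complex_of_vec :: "real^2 \<Rightarrow> complex" where
  "complex_of_vec v = Complex (v $ 1) (v $ 2)"

definition vec_of_complex :: "complex \<Rightarrow> real^2" where
  "vec_of_complex z = vector [Re z, Im z]"

lemma vec_of_complex_inverse [simp]: "complex_of_vec (vec_of_complex z) = z"
  by (simp add: complex_of_vec_def vec_of_complex_def)

lemma complex_of_vec_inverse [simp]: "vec_of_complex (complex_of_vec v) = v"
  by (simp add: complex_of_vec_def vec_of_complex_def vec_eq_iff forall_2)

lemma bounded_linear_complex_of_vec: "bounded_linear complex_of_vec"
  by (intro linear_conv_bounded_linear[THEN iffD1] linearI)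
    (simp_all add: complex_of_vec_def complex_eq_iff)

lemma bounded_linear_vec_of_complex: "bounded_linear vec_of_complex"
  by (intro linear_conv_bounded_linear[THEN iffD1] linearI)
    (simp_all add: vec_of_complex_def vec_eq_iff forall_2)

lemma borel_measurable_complex_of_vec [measurable]: "complex_of_vec \<in> borel_measurable borel"
  by (intro borel_measurable_continuous_onI linear_continuous_on bounded_linear_complex_of_vec)

lemma lborel_complex_eq_distr: "lborel = distr lborel borel complex_of_vec"
proof (rule lborel_eqI)
  fix l u :: complex
  assume "\<And>b. b \<in> Basis \<Longrightarrow> l \<bullet> b \<le> u \<bullet> b"
  then have le: "Re l \<le> Re u" "Im l \<le> Im u"
    by (force simp: Basis_complex_def)+
  have Basis2: "(Basis :: (real^2) set) = {axis 1 1, axis 2 1}"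
    by (auto simp: Basis_vec_def UNIV_2)
  have ne: "axis (1::2) (1::real) \<noteq> axis 2 1"
    by (simp add: axis_eq_axis)
  have "complex_of_vec -` box l u = box (vec_of_complex l) (vec_of_complex u)"
    by (auto simp: box_def Basis2 Basis_complex_def complex_of_vec_def vec_of_complex_def
        inner_axis)
  moreover have "emeasure lborel (box (vec_of_complex l) (vec_of_complex u)) =
      (\<Prod>b\<in>Basis. (vec_of_complex u - vec_of_complex l) \<bullet> b)"
    by (rule emeasure_lborel_box) (use le in \<open>auto simp: Basis2 vec_of_complex_def inner_axis\<close>)
  moreover have "\<dots> = (\<Prod>b\<in>Basis. (u - l) \<bullet> b)"
    using ne by (simp add: Basis2 Basis_complex_def vec_of_complex_def inner_axis)
  ultimately show "emeasure (distr lborel borel complex_of_vec) (box l u) = (\<Prod>b\<in>Basis. (u - l) \<bullet> b)"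
    by (subst emeasure_distr) auto
qed simp

lemma det_complex_mult:
  "det (matrix (\<lambda>h. vec_of_complex (c * complex_of_vec h))) = (cmod c)\<^sup>2"
  by (simp add: det_2 matrix_def vec_of_complex_def complex_of_vec_def axis_def cmod_power2
      flip: power2_eq_square)

text \<open>
  The real Jacobian determinant of a holomorphic map is the squared modulus of its derivative
  (\<^emph>\<open>det_complex_mult\<close>). Without injectivity this is an inequality only, because points with
  several preimages are counted several times on the right; the inequality suffices for norm bounds.
\<close>

lemma holomorphic_image_integral_bound:
  fixes f :: "complex \<Rightarrow> real"
  assumes "open S" and g: "g holomorphic_on S"
    and nonneg: "\<And>w. w \<in> g ` S \<Longrightarrow> 0 \<le> f w"
    and meas: "set_borel_measurable lborel (g ` S) f"
    and int: "set_integrable lborel S (\<lambda>z. (cmod (deriv g z))\<^sup>2 * f (g z))"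
  shows "set_integrable lborel (g ` S) f"
    and "(LINT w:g ` S|lborel. f w) \<le> (LINT z:S|lborel. (cmod (deriv g z))\<^sup>2 * f (g z))"
proof -
  let ?T = complex_of_vec and ?R = vec_of_complex
  let ?h = "\<lambda>z. (cmod (deriv g z))\<^sup>2 * f (g z)"
  define S' where "S' = ?T -` S"
  define G where "G = (\<lambda>v. ?R (g (?T v)))"
  define G' where "G' = (\<lambda>v h. ?R (deriv g (?T v) * ?T h))"
  have T[measurable]: "?T \<in> lborel \<rightarrow>\<^sub>M borel" by simp
  have image: "G ` S' = ?T -` (g ` S)"
  proof (intro equalityI subsetI)
    fix v assume "v \<in> ?T -` g ` S"
    then obtain z where "z \<in> S" "?T v = g z" by auto
    then have "v = G (?R z)" "?R z \<in> S'"
      by (auto simp: G_def S'_def) (metis complex_of_vec_inverse)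
    then show "v \<in> G ` S'" by blast
  qed (auto simp: G_def S'_def)
  have der: "(G has_derivative G' v) (at v within S')" if "v \<in> S'" for v
  proof -
    have "(g has_field_derivative deriv g (?T v)) (at (?T v))"
      using g \<open>open S\<close> that by (auto simp: S'_def intro: holomorphic_derivI)
    then have "(g has_derivative (*) (deriv g (?T v))) (at (?T v))"
      by (simp add: has_field_derivative_def)
    from has_derivative_compose[OF bounded_linear_imp_has_derivative[OF bounded_linear_complex_of_vec]
        this, of UNIV]
    have "((\<lambda>v. g (?T v)) has_derivative (\<lambda>h. deriv g (?T v) * ?T h)) (at v)" by simp
    from bounded_linear.has_derivative[OF bounded_linear_vec_of_complex this]
    show ?thesis unfolding G_def G'_def by (rule has_derivative_at_withinI)
  qed
  have transfer: "integrable lborel (\<lambda>z. indicator A z *\<^sub>R k z) \<longleftrightarrow>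
        set_integrable lborel (?T -` A) (\<lambda>v. k (?T v))"
    "(LINT z:A|lborel. k z) = (LINT v:(?T -` A)|lborel. k (?T v))"
    if "set_borel_measurable lborel A k" for A and k :: "complex \<Rightarrow> real"
  proof -
    have k: "(\<lambda>z. indicator A z *\<^sub>R k z) \<in> borel_measurable borel"
      using that by (simp add: set_borel_measurable_def)
    show "integrable lborel (\<lambda>z. indicator A z *\<^sub>R k z) \<longleftrightarrow>
        set_integrable lborel (?T -` A) (\<lambda>v. k (?T v))"
      unfolding set_integrable_def
      by (subst lborel_complex_eq_distr, subst integrable_distr_eq[OF T k])
        (simp add: indicator_vimage)
    show "(LINT z:A|lborel. k z) = (LINT v:(?T -` A)|lborel. k (?T v))"
      unfolding set_lebesgue_integral_def
      by (subst lborel_complex_eq_distr, subst integral_distr[OF T k])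
        (simp add: indicator_vimage)
  qed
  have meas_h: "set_borel_measurable lborel S ?h"
    using int by (simp add: set_integrable_def set_borel_measurable_def)
  have h: "set_integrable lborel S' (\<lambda>v. ?h (?T v))"
    using int transfer(1)[OF meas_h] by (simp add: set_integrable_def[of lborel S] S'_def)
  have Gh: "\<bar>det (matrix (G' v))\<bar> * f (?T (G v)) = ?h (?T v)" for v
    by (simp add: G'_def G_def det_complex_mult)
  have "(\<lambda>v. \<bar>det (matrix (G' v))\<bar> * f (?T (G v))) integrable_on S'"
    unfolding Gh by (rule set_borel_integral_eq_integral(1)[OF h])
  then have *: "(\<lambda>v. f (?T v)) integrable_on G ` S' \<and>
      integral (G ` S') (\<lambda>v. f (?T v)) \<le> integral S' (\<lambda>v. \<bar>det (matrix (G' v))\<bar> * f (?T (G v)))"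
    by (rule integral_on_image_ubound_nonneg[OF _ der, rotated 2]) (auto intro!: nonneg simp: G_def S'_def)
  then have "(\<lambda>v. f (?T v)) absolutely_integrable_on G ` S'"
    by (intro nonnegative_absolutely_integrable_1) (auto simp: image intro: nonneg)
  moreover have "(\<lambda>v. indicator (?T -` g ` S) v *\<^sub>R f (?T v)) \<in> borel_measurable lborel"
    using measurable_compose[OF T, of "\<lambda>z. indicator (g ` S) z *\<^sub>R f z"] meas
    by (simp add: set_borel_measurable_def indicator_vimage)
  ultimately have f: "set_integrable lborel (?T -` g ` S) (\<lambda>v. f (?T v))"
    unfolding image set_integrable_def by (subst (asm) integrable_completion) auto
  then show "set_integrable lborel (g ` S) f"
    using transfer(1)[OF meas] by (simp add: set_integrable_def[of lborel "g ` S"])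
  show "(LINT w:g ` S|lborel. f w) \<le> (LINT z:S|lborel. ?h z)"
    using * set_borel_integral_eq_integral(2)[OF f] set_borel_integral_eq_integral(2)[OF h]
    unfolding transfer(2)[OF meas] transfer(2)[OF meas_h] Gh image by (simp add: S'_def)
qed


section \<open>The parabolic flow of the disk\<close>

text \<open>
  In the coordinate \<open>(z + 1) / (z - 1)\<close> these maps are the translations by \<open>- b\<close>
  (\<^emph>\<open>cayley_parabolic_flow\<close>), whence the group law \<^emph>\<open>parabolic_flow_add\<close>.
\<close>

definition parabolic_flow :: "complex \<Rightarrow> complex \<Rightarrow> complex" where
  "parabolic_flow b z = ((2 - b) * z + b) / (- b * z + 2 + b)"

lemma parabolic_flow_denominator:
  assumes "Re b = 0" "z \<in> \<D>"
  shows "cmod ((2 - b) * z + b) < cmod (- b * z + 2 + b)" and "- b * z + 2 + b \<noteq> 0"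
proof -
  have "(cmod (- b * z + 2 + b))\<^sup>2 - (cmod ((2 - b) * z + b))\<^sup>2 = 4 * (1 - (cmod z)\<^sup>2)"
    using assms(1) unfolding cmod_power2 by (simp add: power2_eq_square algebra_simps)
  moreover have "(cmod z)\<^sup>2 < 1"
    using assms(2) by (simp add: power_less_one_iff)
  ultimately have "(cmod ((2 - b) * z + b))\<^sup>2 < (cmod (- b * z + 2 + b))\<^sup>2"
    by simp
  then show *: "cmod ((2 - b) * z + b) < cmod (- b * z + 2 + b)"
    by (rule power_less_imp_less_base) simp
  then show "- b * z + 2 + b \<noteq> 0"
    by (metis norm_ge_zero norm_zero not_less)
qed

lemma parabolic_flow_in_disk: "Re b = 0 \<Longrightarrow> z \<in> \<D> \<Longrightarrow> parabolic_flow b z \<in> \<D>"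
  using parabolic_flow_denominator[of b z]
  by (simp add: parabolic_flow_def norm_divide divide_less_eq)

lemma cayley_parabolic_flow:
  assumes "Re b = 0" "z \<in> \<D>"
  shows "(parabolic_flow b z + 1) / (parabolic_flow b z - 1) = (z + 1) / (z - 1) - b"
proof -
  define d where "d = - b * z + 2 + b"
  have d: "d \<noteq> 0" and z: "z \<noteq> 1"
    using parabolic_flow_denominator[OF assms] assms(2) by (auto simp: d_def)
  have eq: "parabolic_flow b z + 1 = 2 * (z + 1 - b * (z - 1)) / d"
    "parabolic_flow b z - 1 = 2 * (z - 1) / d"
    using d by (simp_all add: parabolic_flow_def d_def[symmetric] divide_simps)
      (simp_all add: d_def algebra_simps)
  show ?thesis
    unfolding eq using d z by (simp add: field_simps)
qed

lemma cayley_inject: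
  fixes z w :: complex
  assumes "z \<noteq> 1" "w \<noteq> 1" "(z + 1) / (z - 1) = (w + 1) / (w - 1)"
  shows "z = w"
proof -
  have "(z + 1) * (w - 1) = (w + 1) * (z - 1)"
    using assms by (simp add: frac_eq_eq)
  then show ?thesis by (simp add: algebra_simps)
qed

lemma parabolic_flow_add:
  assumes "Re b = 0" "Re c = 0" "z \<in> \<D>"
  shows "parabolic_flow b (parabolic_flow c z) = parabolic_flow (b + c) z"
proof -
  have in_disk: "parabolic_flow c z \<in> \<D>" "parabolic_flow b (parabolic_flow c z) \<in> \<D>"
    "parabolic_flow (b + c) z \<in> \<D>"
    using assms by (simp_all add: parabolic_flow_in_disk del: mem_ball mem_ball_0)
  show ?thesis
  proof (rule cayley_inject)
    show "(parabolic_flow b (parabolic_flow c z) + 1) / (parabolic_flow b (parabolic_flow c z) - 1) =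
        (parabolic_flow (b + c) z + 1) / (parabolic_flow (b + c) z - 1)"
      using assms in_disk by (simp add: cayley_parabolic_flow del: mem_ball mem_ball_0)
  qed (use in_disk in auto)
qed

lemma parabolic_flow_0: "parabolic_flow 0 z = z"
  by (simp add: parabolic_flow_def)

lemma parabolic_flow_image_disk:
  assumes "Re b = 0"
  shows "parabolic_flow b ` \<D> = \<D>"
proof
  show "parabolic_flow b ` \<D> \<subseteq> \<D>"
    using assms parabolic_flow_in_disk by blast
  show "\<D> \<subseteq> parabolic_flow b ` \<D>"
  proof
    fix z assume "z \<in> \<D>"
    then have "z = parabolic_flow b (parabolic_flow (- b) z)" "parabolic_flow (- b) z \<in> \<D>"
      using assms parabolic_flow_add[of b "- b" z] parabolic_flow_in_disk[of "- b" z]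
      by (simp_all add: parabolic_flow_0)
    then show "z \<in> parabolic_flow b ` \<D>" by blast
  qed
qed

lemma has_field_derivative_parabolic_flow:
  assumes "Re b = 0" "z \<in> \<D>"
  shows "(parabolic_flow b has_field_derivative 4 / (- b * z + 2 + b)\<^sup>2) (at z)"
proof -
  have d: "- b * z + 2 + b \<noteq> 0"
    by (rule parabolic_flow_denominator(2)[OF assms])
  have "((\<lambda>z. ((2 - b) * z + b) / (- b * z + 2 + b)) has_field_derivative
      ((2 - b) * (- b * z + 2 + b) - ((2 - b) * z + b) * (- b)) /
        ((- b * z + 2 + b) * (- b * z + 2 + b))) (at z)"
    using d by (auto intro!: derivative_eq_intros)
  moreover have "(2 - b) * (- b * z + 2 + b) - ((2 - b) * z + b) * (- b) = 4"
    by (simp add: algebra_simps)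
  ultimately show ?thesis
    by (simp only: parabolic_flow_def[abs_def] power2_eq_square)
qed

lemma holomorphic_on_parabolic_flow: "Re b = 0 \<Longrightarrow> parabolic_flow b holomorphic_on \<D>"
  using has_field_derivative_parabolic_flow
  by (subst holomorphic_on_open) blast+

text \<open>
  The derivative is \<open>4 / (2 + b - b z)\<^sup>2\<close>. On the disk the denominator has modulus at least
  \<open>|2 + b| - |b|\<close>, which equals \<open>4 / (|2 + b| + |b|)\<close> because \<open>|2 + b|\<^sup>2 - |b|\<^sup>2 = 4\<close> for imaginary
  \<open>b\<close>. What matters is that the bound is polynomial in \<open>b\<close>, hence along the iterates.
\<close>

lemma cmod_deriv_parabolic_flow_le:
  assumes "Re b = 0" "z \<in> \<D>"
  shows "cmod (deriv (parabolic_flow b) z) \<le> (1 + cmod b)\<^sup>2"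
proof -
  have "(cmod (2 + b))\<^sup>2 = 4 + (cmod b)\<^sup>2"
    using assms(1) unfolding cmod_power2 by simp
  then have prod: "(cmod (2 + b) - cmod b) * (cmod (2 + b) + cmod b) = 4"
    by (simp add: algebra_simps power2_eq_square)
  have sum_le: "cmod (2 + b) + cmod b \<le> 2 * (1 + cmod b)"
    using norm_triangle_ineq[of 2 b] by simp
  have pos: "cmod (2 + b) - cmod b > 0"
  proof (rule ccontr)
    assume "\<not> ?thesis"
    then have "(cmod (2 + b) - cmod b) * (cmod (2 + b) + cmod b) \<le> 0"
      by (intro mult_nonpos_nonneg) auto
    with prod show False by simp
  qed
  have "cmod (b * z) \<le> cmod b"
    using assms(2) by (simp add: norm_mult mult_left_le)
  then have d: "cmod (2 + b) - cmod b \<le> cmod (- b * z + 2 + b)"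
    using norm_triangle_ineq2[of "2 + b" "b * z"] by (simp add: algebra_simps)
  have "4 \<le> (cmod (2 + b) - cmod b) * (2 * (1 + cmod b))"
    unfolding prod[symmetric] using sum_le pos by (intro mult_left_mono) auto
  also have "\<dots> \<le> cmod (- b * z + 2 + b) * (2 * (1 + cmod b))"
    using d by (intro mult_right_mono) auto
  finally have "2 \<le> cmod (- b * z + 2 + b) * (1 + cmod b)" by (simp add: algebra_simps)
  then have "2\<^sup>2 \<le> (cmod (- b * z + 2 + b) * (1 + cmod b))\<^sup>2"
    by (intro power_mono) auto
  then have "4 / (cmod (- b * z + 2 + b))\<^sup>2 \<le> (1 + cmod b)\<^sup>2"
    using parabolic_flow_denominator(2)[OF assms]
    by (simp add: power_mult_distrib divide_le_eq mult.commute)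
  then show ?thesis
    using DERIV_imp_deriv[OF has_field_derivative_parabolic_flow[OF assms]]
    by (simp add: norm_divide norm_power)
qed

section \<open>Composition and multiplication operators\<close>

lemma set_integrable_bergman: "set_integrable lborel \<D> (\<lambda>z. (cmod (bergman_fun f z))\<^sup>2)"
  using bergman_fun[of f] by auto

lemma set_borel_measurable_continuous_disk:
  fixes h :: "complex \<Rightarrow> real"
  shows "continuous_on \<D> h \<Longrightarrow> set_borel_measurable lborel \<D> h"
  using borel_measurable_continuous_on_indicator[of \<D> h] by (simp add: set_borel_measurable_def)

lemma holomorphic_compose_parabolic_flow:
  assumes "Re b = 0"
  shows "(\<lambda>z. bergman_fun f (parabolic_flow b z)) holomorphic_on \<D>"
  using holomorphic_on_compose_gen[OF holomorphic_on_parabolic_flow[OF assms] bergman_holomorphic]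
    parabolic_flow_image_disk[OF assms] by (simp add: o_def)

text \<open>
  Substitution along the inverse flow \<open>parabolic_flow (- b)\<close>, which maps the disk onto itself and
  undoes the composition; its Jacobian is at most \<open>(1 + |b|)\<^sup>4\<close>.
\<close>

lemma integrable_compose_parabolic_flow:
  assumes b: "Re b = 0"
  shows "set_integrable lborel \<D> (\<lambda>z. (cmod (bergman_fun f (parabolic_flow b z)))\<^sup>2)" (is ?int)
    and "(LINT z:\<D>|lborel. (cmod (bergman_fun f (parabolic_flow b z)))\<^sup>2) \<le>
      (1 + cmod b) ^ 4 * (LINT z:\<D>|lborel. (cmod (bergman_fun f z))\<^sup>2)" (is "?I \<le> _ * ?J")
proof -
  let ?g = "parabolic_flow (- b)"
  let ?F = "\<lambda>z. (cmod (bergman_fun f (parabolic_flow b z)))\<^sup>2"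
  let ?D = "\<lambda>z. (cmod (deriv ?g z))\<^sup>2"
  have b': "Re (- b) = 0" using b by simp
  have g: "?g holomorphic_on \<D>" by (rule holomorphic_on_parabolic_flow[OF b'])
  have image: "?g ` \<D> = \<D>" by (rule parabolic_flow_image_disk[OF b'])
  have Fg: "?F (?g z) = (cmod (bergman_fun f z))\<^sup>2" if "z \<in> \<D>" for z
    using parabolic_flow_add[OF b b' that] by (simp add: parabolic_flow_0)
  have D: "?D z \<le> (1 + cmod b) ^ 4" if "z \<in> \<D>" for z
    using power_mono[OF cmod_deriv_parabolic_flow_le[OF b' that], of 2] by simp
  have cont_F: "continuous_on \<D> ?F"
    by (intro continuous_intros holomorphic_on_imp_continuous_on
        holomorphic_compose_parabolic_flow b)
  have "continuous_on \<D> (\<lambda>z. ?D z * (cmod (bergman_fun f z))\<^sup>2)"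
    by (intro continuous_intros holomorphic_on_imp_continuous_on holomorphic_deriv g
        bergman_holomorphic) simp
  then have meas: "set_borel_measurable lborel \<D> (\<lambda>z. ?D z * (cmod (bergman_fun f z))\<^sup>2)"
    by (rule set_borel_measurable_continuous_disk)
  have bound: "set_integrable lborel \<D> (\<lambda>z. (1 + cmod b) ^ 4 * (cmod (bergman_fun f z))\<^sup>2)"
    by (intro set_integrable_mult_right set_integrable_bergman)
  have int': "set_integrable lborel \<D> (\<lambda>z. ?D z * (cmod (bergman_fun f z))\<^sup>2)"
    by (rule set_integrable_bound[OF bound meas])
      (use D in \<open>auto simp: abs_mult intro!: mult_right_mono\<close>)
  then have int: "set_integrable lborel \<D> (\<lambda>z. ?D z * ?F (?g z))"
    by (subst set_integrable_cong[OF refl refl]) (simp_all add: Fg)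
  note * = holomorphic_image_integral_bound[OF open_ball g, of ?F, unfolded image,
      OF _ set_borel_measurable_continuous_disk[OF cont_F] int]
  show ?int by (rule *(1)) simp
  have "?I \<le> (LINT z:\<D>|lborel. ?D z * ?F (?g z))" by (rule *(2)) simp
  also have "\<dots> = (LINT z:\<D>|lborel. ?D z * (cmod (bergman_fun f z))\<^sup>2)"
    by (intro set_lebesgue_integral_cong) (auto simp: Fg)
  also have "\<dots> \<le> (LINT z:\<D>|lborel. (1 + cmod b) ^ 4 * (cmod (bergman_fun f z))\<^sup>2)"
    by (intro set_integral_mono int' bound mult_right_mono D) auto
  also have "\<dots> = (1 + cmod b) ^ 4 * ?J" by simp
  finally show "?I \<le> (1 + cmod b) ^ 4 * ?J" .
qed

lemma bergman_fun_composition_parabolic: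
  assumes b: "Re b = 0" and z: "z \<in> \<D>"
  shows "bergman_fun (composition_operator (parabolic_flow b) f) z = bergman_fun f (parabolic_flow b z)"
proof -
  let ?h = "\<lambda>z. if z \<in> \<D> then bergman_fun f (parabolic_flow b z) else 0"
  have "?h holomorphic_on \<D>"
    by (rule holomorphic_transform[OF holomorphic_compose_parabolic_flow[OF b]]) simp
  moreover have "set_integrable lborel \<D> (\<lambda>z. (cmod (?h z))\<^sup>2)"
    by (subst set_integrable_cong[OF refl refl, of _ _ "\<lambda>z. (cmod (bergman_fun f (parabolic_flow b z)))\<^sup>2"])
      (simp_all add: integrable_compose_parabolic_flow[OF b])
  ultimately show ?thesis
    using z by (simp add: composition_operator_def Abs_bergman_inverse)
qed

lemma norm_composition_parabolic_le:
  assumes b: "Re b = 0"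
  shows "norm (composition_operator (parabolic_flow b) f) \<le> (1 + cmod b)\<^sup>2 * norm f"
proof -
  have "(LINT z:\<D>|lborel. (cmod (bergman_fun (composition_operator (parabolic_flow b) f) z))\<^sup>2) =
      (LINT z:\<D>|lborel. (cmod (bergman_fun f (parabolic_flow b z)))\<^sup>2)"
    by (intro set_lebesgue_integral_cong)
      (auto simp: bergman_fun_composition_parabolic[OF b] simp del: mem_ball mem_ball_0)
  also have "\<dots> \<le> (1 + cmod b) ^ 4 * (LINT z:\<D>|lborel. (cmod (bergman_fun f z))\<^sup>2)"
    by (rule integrable_compose_parabolic_flow(2)[OF b])
  finally have le: "norm (composition_operator (parabolic_flow b) f) \<le>
      sqrt ((1 + cmod b) ^ 4 * (1 / pi * (LINT z:\<D>|lborel. (cmod (bergman_fun f z))\<^sup>2)))"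
    unfolding norm_bergman_def by (simp add: divide_right_mono)
  have "sqrt ((1 + cmod b) ^ 4) = (1 + cmod b)\<^sup>2"
    using real_sqrt_abs[of "(1 + cmod b)\<^sup>2"] by simp
  with le show ?thesis
    by (simp add: norm_bergman_def real_sqrt_mult real_sqrt_divide)
qed

lemma composition_parabolic_add:
  assumes "Re b = 0" "Re c = 0"
  shows "composition_operator (parabolic_flow b) (composition_operator (parabolic_flow c) f) =
    composition_operator (parabolic_flow (b + c)) f"
  using assms
  by (intro bergman_eqI) (simp add: bergman_fun_composition_parabolic parabolic_flow_in_disk
      parabolic_flow_add add.commute del: mem_ball mem_ball_0)

lemma composition_parabolic_0 [simp]: "composition_operator (parabolic_flow 0) f = f"
  by (intro bergman_eqI)
    (simp add: bergman_fun_composition_parabolic parabolic_flow_0 del: mem_ball mem_ball_0)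

lemma composition_parabolic_scaleC:
  assumes "Re b = 0"
  shows "composition_operator (parabolic_flow b) (c *\<^sub>C f) =
    c *\<^sub>C composition_operator (parabolic_flow b) f"
  using assms by (intro bergman_eqI) (simp add: bergman_fun_composition_parabolic
      scaleC_bergman.rep_eq del: mem_ball mem_ball_0)

lemma composition_parabolic_funpow:
  assumes "Re b = 0"
  shows "(composition_operator (parabolic_flow b) ^^ n) f =
    composition_operator (parabolic_flow (of_nat n * b)) f"
  by (induction n) (use assms in \<open>simp_all add: composition_parabolic_add algebra_simps\<close>)

text \<open>Meant for \<open>h\<close> holomorphic and bounded on the disk.\<close>

definition multiplication_operator :: "(complex \<Rightarrow> complex) \<Rightarrow> bergman \<Rightarrow> bergman" where
  "multiplication_operator h f = Abs_bergman (\<lambda>z. if z \<in> \<D> then h z * bergman_fun f z else 0)"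

lemma bergman_fun_multiplication_operator:
  assumes h: "h holomorphic_on \<D>" and M: "\<And>z. z \<in> \<D> \<Longrightarrow> cmod (h z) \<le> M" and z: "z \<in> \<D>"
  shows "bergman_fun (multiplication_operator h f) z = h z * bergman_fun f z"
proof -
  let ?k = "\<lambda>z. if z \<in> \<D> then h z * bergman_fun f z else 0"
  have hf: "(\<lambda>z. h z * bergman_fun f z) holomorphic_on \<D>"
    by (intro holomorphic_intros h bergman_holomorphic)
  then have hol: "?k holomorphic_on \<D>" by (rule holomorphic_transform) simp
  have meas: "set_borel_measurable lborel \<D> (\<lambda>z. (cmod (?k z))\<^sup>2)"
    by (intro set_borel_measurable_continuous_disk continuous_intros
        holomorphic_on_imp_continuous_on[OF hol])
  have "set_integrable lborel \<D> (\<lambda>z. M\<^sup>2 * (cmod (bergman_fun f z))\<^sup>2)"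
    by (intro set_integrable_mult_right set_integrable_bergman)
  then have "set_integrable lborel \<D> (\<lambda>z. (cmod (?k z))\<^sup>2)"
    using meas
  proof (rule set_integrable_bound)
    show "AE z in lborel. z \<in> \<D> \<longrightarrow>
        norm ((cmod (?k z))\<^sup>2) \<le> norm (M\<^sup>2 * (cmod (bergman_fun f z))\<^sup>2)"
      using M by (auto simp: norm_mult power_mult_distrib intro!: mult_right_mono power_mono)
  qed
  with hol z show ?thesis
    by (simp add: multiplication_operator_def Abs_bergman_inverse)
qed

lemma bounded_clinear_multiplication_operator:
  assumes h: "h holomorphic_on \<D>" and M: "\<And>z. z \<in> \<D> \<Longrightarrow> cmod (h z) \<le> M"
  shows "bounded_clinear (multiplication_operator h)"
proof -
  note [simp] = bergman_fun_multiplication_operator[OF h M]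
  have "cmod (h 0) \<le> M" using M[of 0] by simp
  then have M0: "0 \<le> M" using norm_ge_zero[of "h 0"] by linarith
  have "norm (multiplication_operator h f) \<le> norm f * M" for f
  proof -
    have "(LINT z:\<D>|lborel. (cmod (bergman_fun (multiplication_operator h f) z))\<^sup>2) \<le>
        (LINT z:\<D>|lborel. M\<^sup>2 * (cmod (bergman_fun f z))\<^sup>2)"
      by (intro set_integral_mono set_integrable_mult_right set_integrable_bergman)
        (use M in \<open>auto simp: norm_mult power_mult_distrib simp del: mem_ball mem_ball_0
          intro!: mult_right_mono power_mono\<close>)
    then have "norm (multiplication_operator h f) \<le>
        sqrt (M\<^sup>2 * (1 / pi * (LINT z:\<D>|lborel. (cmod (bergman_fun f z))\<^sup>2)))"
      unfolding norm_bergman_def by (simp add: divide_right_mono)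
    then show ?thesis
      using M0 by (simp add: norm_bergman_def real_sqrt_mult real_sqrt_divide mult.commute)
  qed
  then have "bounded_linear (multiplication_operator h)"
    by (intro bounded_linear_intro[where K = M] bergman_eqI)
      (simp_all add: plus_bergman.rep_eq scaleR_bergman.rep_eq algebra_simps del: mem_ball mem_ball_0)
  moreover have "multiplication_operator h (c *\<^sub>C f) = c *\<^sub>C multiplication_operator h f" for c f
    by (intro bergman_eqI) (simp add: scaleC_bergman.rep_eq del: mem_ball mem_ball_0)
  ultimately show ?thesis by (simp add: bounded_clinear_def)
qed

lemma multiplication_operator_nonzero:
  assumes h: "h holomorphic_on \<D>" and M: "\<And>z. z \<in> \<D> \<Longrightarrow> cmod (h z) \<le> M" and "h 0 \<noteq> 0"
  shows "multiplication_operator h \<noteq> (\<lambda>f. 0)"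
proof
  \<comment> \<open>The constant function \<open>1\<close>, cut off outside the disk, is mapped to \<open>h\<close>.\<close>
  let ?one = "\<lambda>z::complex. if z \<in> \<D> then 1 else 0 :: complex"
  assume zero: "multiplication_operator h = (\<lambda>f. 0)"
  have "set_integrable lborel \<D> (\<lambda>z. (cmod (?one z))\<^sup>2)"
  proof (subst set_integrable_cong[OF refl refl, of _ _ "\<lambda>z. 1 :: real"])
    show "set_integrable lborel \<D> (\<lambda>z. 1 :: real)"
      unfolding set_integrable_def
      using integrable_real_indicator[OF _ emeasure_lborel_ball_finite[of "0::complex" 1]] by simp
  qed simp
  moreover have "?one holomorphic_on \<D>"
    by (rule holomorphic_transform[OF holomorphic_on_const[of 1]]) simp
  ultimately have "bergman_fun (Abs_bergman ?one) 0 = 1"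
    by (subst Abs_bergman_inverse) auto
  then have "bergman_fun (multiplication_operator h (Abs_bergman ?one)) 0 = h 0"
    by (subst bergman_fun_multiplication_operator[OF h M]) auto
  with zero \<open>h 0 \<noteq> 0\<close> show False by (simp add: zero_bergman.rep_eq)
qed

section \<open>Extended eigenvalues of operators with powers of polynomial growth\<close>

lemma polynomial_over_exponential_tendsto_0:
  fixes c r :: real
  assumes "0 \<le> c" "1 < r"
  shows "(\<lambda>n. (1 + real n * c) ^ k / r ^ n) \<longlonglongrightarrow> 0"
proof (cases "k = 0")
  case True
  with assms show ?thesis by simp real_asymp
next
  case False
  \<comment> \<open>The expression is the \<open>k\<close>-th power of a linear term over an exponential with base \<open>root k r\<close>.\<close>
  have s: "1 < root k r" using False assms by simp
  have "(\<lambda>n. ((1 + real n * c) / root k r ^ n) ^ k) \<longlonglongrightarrow> 0 ^ k"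
    using assms(1) s by (intro tendsto_power) real_asymp
  moreover have "((1 + real n * c) / root k r ^ n) ^ k = (1 + real n * c) ^ k / r ^ n" for n
    using False assms
    by (simp add: power_divide mult.commute[of n] power_mult flip: power_mult[of "root k r" n k])
  ultimately show ?thesis using False by (simp add: power_0_left)
qed

text \<open>
  Here \<open>A\<^sup>n X B\<^sup>n = \<mu>\<^sup>n X\<close>, so the norm of \<open>X f\<close> is bounded by a polynomial in \<open>n\<close> divided by
  \<open>|\<mu>|\<^sup>n\<close>.
\<close>

lemma polynomial_growth_intertwiner_eq_0:
  fixes A B X :: "'a::complex_inner_space \<Rightarrow> 'a"
  assumes X: "bounded_clinear X" and AX: "\<And>f. A (X f) = \<mu> *\<^sub>C X (A f)"
    and A: "\<And>c f. A (c *\<^sub>C f) = c *\<^sub>C A f" and AB: "\<And>f. A (B f) = f"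
    and norm_A: "\<And>n f. norm ((A ^^ n) f) \<le> (1 + real n * c) ^ k * norm f"
    and norm_B: "\<And>n f. norm ((B ^^ n) f) \<le> (1 + real n * c) ^ k * norm f"
    and "0 \<le> c" and \<mu>: "1 < cmod \<mu>"
  shows "X f = 0"
proof -
  have Xl: "bounded_linear X" and Xc: "\<And>c f. X (c *\<^sub>C f) = c *\<^sub>C X f"
    using X by (auto simp: bounded_clinear_def)
  obtain K where K: "\<And>f. norm (X f) \<le> norm f * K" "K \<ge> 0"
    using bounded_linear.nonneg_bounded[OF Xl] by blast
  have AnX: "(A ^^ n) (X f) = (\<mu> ^ n) *\<^sub>C X ((A ^^ n) f)" for n f
  proof (induction n)
    case 0
    have "(1::complex) *\<^sub>C X f = X f" using scaleC_of_real[of 1 "X f"] by simp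
    then show ?case by simp
  next
    case (Suc n)
    then show ?case by (simp add: A AX scaleC_scaleC mult.commute)
  qed
  have AnBn: "(A ^^ n) ((B ^^ n) f) = f" for n f
    by (induction n arbitrary: f) (simp_all add: AB funpow_swap1)
  have bound: "norm (X f) \<le> (1 + real n * c) ^ (2 * k) / cmod \<mu> ^ n * (K * norm f)" for n
  proof -
    let ?p = "(1 + real n * c) ^ k"
    have p: "0 \<le> ?p" using \<open>0 \<le> c\<close> by simp
    have "cmod \<mu> ^ n * norm (X f) = norm ((A ^^ n) (X ((B ^^ n) f)))"
      by (simp add: AnX AnBn norm_scaleC norm_power)
    also have "\<dots> \<le> ?p * norm (X ((B ^^ n) f))" by (rule norm_A)
    also have "\<dots> \<le> ?p * (norm ((B ^^ n) f) * K)"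
      by (intro mult_left_mono K p)
    also have "\<dots> \<le> ?p * ((?p * norm f) * K)"
      by (intro mult_left_mono mult_right_mono norm_B p K)
    finally have "norm (X f) \<le> ?p * ((?p * norm f) * K) / cmod \<mu> ^ n"
      using \<mu> by (subst pos_le_divide_eq) (auto simp: mult_ac intro!: zero_less_power)
    moreover have "?p * ?p = (1 + real n * c) ^ (2 * k)"
      by (simp add: mult_2 power_add)
    ultimately show ?thesis by (simp add: mult_ac)
  qed
  have "(\<lambda>n. (1 + real n * c) ^ (2 * k) / cmod \<mu> ^ n) \<longlonglongrightarrow> 0"
    by (rule polynomial_over_exponential_tendsto_0[OF \<open>0 \<le> c\<close> \<mu>])
  then have "(\<lambda>n. (1 + real n * c) ^ (2 * k) / cmod \<mu> ^ n * (K * norm f)) \<longlonglongrightarrow> 0"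
    by (rule tendsto_mult_left_zero)
  then have "norm (X f) \<le> 0"
    by (rule LIMSEQ_le_const) (use bound in blast)
  then show ?thesis by simp
qed

text \<open>
  The hypotheses are symmetric in \<open>A\<close> and its inverse \<open>B\<close>, and \<open>X\<close> intertwines \<open>B\<close> with factor
  \<open>1 / \<mu>\<close>, so the preceding lemma excludes both \<open>|\<mu>| > 1\<close> and \<open>|\<mu>| < 1\<close>.
\<close>

lemma extended_eigenvalue_polynomial_growth:
  fixes A B :: "'a::complex_inner_space \<Rightarrow> 'a"
  assumes \<mu>: "\<mu> \<in> extended_eigenvalues A"
    and A: "\<And>c f. A (c *\<^sub>C f) = c *\<^sub>C A f" and B: "\<And>c f. B (c *\<^sub>C f) = c *\<^sub>C B f"
    and AB: "\<And>f. A (B f) = f" and BA: "\<And>f. B (A f) = f"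
    and norm_A: "\<And>n f. norm ((A ^^ n) f) \<le> (1 + real n * c) ^ k * norm f"
    and norm_B: "\<And>n f. norm ((B ^^ n) f) \<le> (1 + real n * c) ^ k * norm f"
    and "0 \<le> c"
  shows "cmod \<mu> = 1"
proof -
  obtain X where X: "bounded_clinear X" and nz: "X \<noteq> (\<lambda>f. 0)"
    and AX: "\<And>f. A (X f) = \<mu> *\<^sub>C X (A f)"
    using \<mu> by (auto simp: extended_eigenvalues_def)
  have scale: "0 *\<^sub>C x = (0::'a)" "1 *\<^sub>C x = x" for x :: 'a
    using scaleC_of_real[of 0 x] scaleC_of_real[of 1 x] by simp_all
  have XBA: "X (B f) = \<mu> *\<^sub>C B (X f)" for f
    using arg_cong[OF AX[of "B f"], of B] by (simp add: AB BA B)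
  have "\<mu> \<noteq> 0"
  proof
    assume "\<mu> = 0"
    then have "X f = 0" for f
      using XBA[of "A f"] by (simp add: BA scale)
    with nz show False by auto
  qed
  then have BX: "B (X f) = inverse \<mu> *\<^sub>C X (B f)" for f
    by (simp add: XBA scaleC_scaleC scale)
  have "\<not> 1 < cmod \<mu>"
    using polynomial_growth_intertwiner_eq_0[OF X AX A AB norm_A norm_B \<open>0 \<le> c\<close>] nz by blast
  moreover have "\<not> 1 < cmod (inverse \<mu>)"
    using polynomial_growth_intertwiner_eq_0[OF X BX B BA norm_B norm_A \<open>0 \<le> c\<close>] nz by blast
  ultimately show ?thesis
    using \<open>\<mu> \<noteq> 0\<close> by (simp add: norm_inverse one_less_inverse_iff)
qed

section \<open>The extended eigenvalues of a parabolic composition operator\<close>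

lemma exp_cayley_holomorphic: "(\<lambda>z. exp (of_real t * ((z + 1) / (z - 1)))) holomorphic_on \<D>"
  by (intro holomorphic_intros) auto

lemma cmod_exp_cayley_le:
  assumes "0 \<le> t" "z \<in> \<D>"
  shows "cmod (exp (of_real t * ((z + 1) / (z - 1)))) \<le> 1"
proof -
  have "(Re z)\<^sup>2 + (Im z)\<^sup>2 < 1"
    using assms(2) by (simp add: cmod_def real_sqrt_lt_1_iff)
  then have "Re ((z + 1) * cnj (z - 1)) \<le> 0"
    by (simp add: power2_eq_square algebra_simps)
  then have "Re ((z + 1) / (z - 1)) \<le> 0"
    by (simp add: Re_complex_div_le_0)
  then show ?thesis
    using assms(1) by (simp add: mult_nonneg_nonpos del: times_divide_eq_right)
qed

text \<open>
  Nonnegativity of \<open>t\<close> is the point: only then is \<open>exp (t w)\<close> bounded on the left half-plane.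
\<close>

lemma unimodular_eq_exp_imaginary:
  assumes "Re a = 0" "a \<noteq> 0" "cmod \<mu> = 1"
  obtains t where "0 \<le> t" "\<mu> = exp (- (of_real t * a))"
proof -
  have im: "Im a \<noteq> 0" and a: "a = \<i> * of_real (Im a)"
    using assms by (auto simp: complex_eq_iff)
  have mu: "\<mu> = exp (\<i> * of_real (Arg \<mu>))"
    using Arg_eq[of \<mu>] assms(3) by fastforce
  \<comment> \<open>The argument of \<open>\<mu>\<close>, shifted by a full turn so that its sign is opposite to that of \<open>Im a\<close>.\<close>
  define s where "s = Arg \<mu> - sgn (Im a) * (2 * pi)"
  have s: "\<mu> = exp (\<i> * of_real s)"
    using im by (subst mu)
      (auto simp: s_def sgn_if exp_eq algebra_simps intro: exI[of _ 1] exI[of _ "-1"])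
  show thesis
  proof
    show "0 \<le> - s / Im a"
      using im Arg_le_pi[of \<mu>] mpi_less_Arg[of \<mu>] pi_gt_zero
      by (auto simp: s_def sgn_if divide_simps)
    have "of_real (- s / Im a) * a = - (\<i> * of_real s)"
      using im by (subst a) simp
    then show "\<mu> = exp (- (of_real (- s / Im a) * a))"
      using s by simp
  qed
qed

theorem theorem4p14:
  fixes a :: complex and \<phi> :: "complex \<Rightarrow> complex"
  assumes "Re a = 0"
    and "\<And>z. z \<in> \<D> \<Longrightarrow> \<phi> z = ((2 - a) * z + a) / (- a * z + 2 + a)"
    and "parabolic_automorphism \<phi>"
  shows "extended_eigenvalues (composition_operator \<phi>) = sphere 0 1"
proof -
  let ?C = "\<lambda>b. composition_operator (parabolic_flow b)"
  have "a \<noteq> 0"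
    using assms(3) parabolic_automorphism_iff[OF assms(1,2)] by blast
  have Re: "Re a = 0" "Re (- a) = 0" using assms(1) by simp_all
  have \<phi>: "composition_operator \<phi> = ?C a"
    using assms(2) by (auto simp: composition_operator_def parabolic_flow_def fun_eq_iff
        intro!: arg_cong[of _ _ Abs_bergman])
  have growth: "norm ((?C b ^^ n) f) \<le> (1 + real n * cmod a) ^ 2 * norm f"
    if "b \<in> {a, - a}" for b n f
    using norm_composition_parabolic_le[of "of_nat n * b" f] that Re
    by (auto simp: composition_parabolic_funpow norm_mult)
  have "cmod \<mu> = 1" if "\<mu> \<in> extended_eigenvalues (?C a)" for \<mu>
    by (rule extended_eigenvalue_polynomial_growth[OF that, of "?C (- a)" "cmod a" 2])
      (use Re growth in \<open>auto simp: composition_parabolic_scaleC composition_parabolic_add\<close>)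
  moreover have "\<mu> \<in> extended_eigenvalues (?C a)" if "cmod \<mu> = 1" for \<mu>
  proof -
    obtain t where t: "0 \<le> t" and \<mu>: "\<mu> = exp (- (of_real t * a))"
      using unimodular_eq_exp_imaginary[OF assms(1) \<open>a \<noteq> 0\<close> \<open>cmod \<mu> = 1\<close>] by blast
    define e :: "complex \<Rightarrow> complex" where "e = (\<lambda>z. exp (of_real t * ((z + 1) / (z - 1))))"
    have e: "e holomorphic_on \<D>" "\<And>z. z \<in> \<D> \<Longrightarrow> cmod (e z) \<le> 1"
      using exp_cayley_holomorphic cmod_exp_cayley_le[OF t] by (auto simp: e_def)
    \<comment> \<open>The flow shifts the exponent by \<open>- t a\<close>.\<close>
    have e_flow: "e (parabolic_flow a z) = \<mu> * e z" if "z \<in> \<D>" for z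
      unfolding e_def cayley_parabolic_flow[OF assms(1) that] \<mu> exp_add[symmetric]
      by (simp add: right_diff_distrib)
    have "?C a (multiplication_operator e f) = \<mu> *\<^sub>C multiplication_operator e (?C a f)" for f
      by (intro bergman_eqI)
        (simp add: bergman_fun_composition_parabolic[OF assms(1)] parabolic_flow_in_disk[OF assms(1)]
          bergman_fun_multiplication_operator[OF e] scaleC_bergman.rep_eq e_flow del: mem_ball mem_ball_0)
    moreover have "multiplication_operator e \<noteq> (\<lambda>f. 0)"
      by (rule multiplication_operator_nonzero[OF e]) (simp_all add: e_def)
    ultimately show ?thesis
      using bounded_clinear_multiplication_operator[OF e]
      unfolding extended_eigenvalues_def by blast
  qed
  ultimately show ?thesis
    unfolding \<phi> by auto
qed

end
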